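(* There holds (a) $\displaystyle\sum_{m\geq 1}\sum_{n\geq 0}\frac{q^{2m+n}(-q;q)_{m-1}^2 (q^3;q^3)_{m+n-1}}{(q;q)_{m}^2(-q;q)_{m+n}^2 (q;q)_{m+n-1}} =\frac{1}{12} \frac{(q^3;q^3)_\infty}{(q;q)_\infty^3} +\frac{1}{4} \frac{(q^3;q^3)_\infty}{(q;q)_\infty (-q;q)_\infty^2}-\frac{1}{3}.$ (b) $\displaystyle\sum_{m\geq 1}\sum_{n\geq 0}\frac{q^{2m+n}(q^3;q^3)_{m-1} (-q;q)_{m+n-1}^2 (q;q)_{m+n}}{(q;q)_{m-1}(q;q)_{m}^2 (q^3;q^3)_{m+n}} =\frac{1}{12} \frac{(-q;q)_\infty^2}{(q;q)_\infty^2} -\frac{1}{3} \frac{(-q;q)_\infty^2 (q;q)_\infty}{(q^3;q^3)_\infty}+\frac{1}{4}.$ (c) $\displaystyle\sum_{m\geq 1}\sum_{n\geq 0}\frac{q^{2m+n}(-q;q)_{m-1}^2 (-q^3;q^3)_{m+n-1}}{(q;q)_{m}^2(-q;q)_{m+n}^2 (-q;q)_{m+n-1}} =\frac{1}{4} \frac{(-q^3;q^3)_\infty}{(-q;q)_\infty (q;q)_\infty^2} +\frac{1}{12} \frac{(-q^3;q^3)_\infty}{(-q;q)_\infty^3}-\frac{1}{3}.$ (d) $\displaystyle\sum_{m\geq 1}\sum_{n\geq 0}\frac{q^{2m+n}(-q^3;q^3)_{m-1} (-q;q)_{m+n-1}^2 (-q;q)_{m+n}}{(-q;q)_{m-1}(q;q)_{m}^2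 (-q^3;q^3)_{m+n}} =\frac{1}{4} \frac{(-q;q)_\infty^2}{(q;q)_\infty^2} -\frac{1}{3} \frac{(-q;q)_\infty^3}{(-q^3;q^3)_\infty}+\frac{1}{12}.$
   Context: Throughout $q$ is a complex number with $|q|<1$. Standard $q$-Pochhammer notation: $(a;q)_0=1$, $(a;q)_n=\prod_{j=0}^{n-1}(1-aq^j)$, $(a;q)_\infty=\prod_{j\geq 0}(1-aq^j)$, and $(a_1,\ldots,a_k;q)_n=\prod_{j}(a_j;q)_n$. *)

theory Defs
  imports "HOL-Analysis.Analysis"
begin

definition qpoch :: "complex \<Rightarrow> complex \<Rightarrow> nat \<Rightarrow> complex" where
  "qpoch a q n = (\<Prod>j<n. 1 - a * q ^ j)"

(* prodinf is only meaningful for a convergent product, which is the case for norm q < 1;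
   factors equal to zero are allowed there. *)
definition qpoch_inf :: "complex \<Rightarrow> complex \<Rightarrow> complex" where
  "qpoch_inf a q = (\<Prod>j. 1 - a * q ^ j)"

end

theory Submission
  imports Defs
begin

text \<open>
  Put \<open>F s n = (\<Prod>j=1..n. 1 + s * q ^ j + q ^ (2 * j))\<close>. For \<open>s = -2, 2, 1, -1\<close> this is
  \<open>(q;q)\<^sub>n\<^sup>2\<close>, \<open>(-q;q)\<^sub>n\<^sup>2\<close>, \<open>(q\<^sup>3;q\<^sup>3)\<^sub>n / (q;q)\<^sub>n\<close> and \<open>(-q\<^sup>3;q\<^sup>3)\<^sub>n / (-q;q)\<^sub>n\<close>, so all four double
  series have the shape \<open>\<Sum>m n. q ^ m * F s (m - 1) / F t m * (q ^ (m + n) * F u (m + n - 1) / F s (m + n))\<close>.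
  Two quadratics \<open>1 + s * x + x\<^sup>2\<close> and \<open>1 + t * x + x\<^sup>2\<close> differ by \<open>(s - t) * x\<close>, hence
  \<open>F s m / F t m - F s (m - 1) / F t (m - 1) = (s - t) * q ^ m * F s (m - 1) / F t m\<close>,
  and both summations telescope.
\<close>

lemma norm_qpow_less_1:
  fixes a q :: complex
  assumes "norm a < 1" "norm q < 1"
  shows "norm (a * q ^ n) < 1"
proof -
  have "norm a * norm q ^ n \<le> norm a * 1"
    using assms by (intro mult_left_mono power_le_one) auto
  with assms show ?thesis
    by (simp add: norm_mult norm_power)
qed

lemma one_minus_qpow_nonzero:
  fixes a q :: complex
  assumes "norm a < 1" "norm q < 1"
  shows "1 - a * q ^ n \<noteq> 0"
  using norm_qpow_less_1[OF assms, of n] by auto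

lemma qpoch_nonzero:
  assumes "norm a < 1" "norm q < 1"
  shows "qpoch a q n \<noteq> 0"
  using one_minus_qpow_nonzero[OF assms] by (simp add: qpoch_def)

lemma convergent_prod_qpoch:
  fixes a q :: complex
  assumes "norm q < 1"
  shows "convergent_prod (\<lambda>j. 1 - a * q ^ j)"
proof -
  have "summable (\<lambda>j. norm a * norm q ^ j)"
    using assms by (intro summable_mult summable_geometric) auto
  then have "abs_convergent_prod (\<lambda>j. 1 - a * q ^ j)"
    by (intro summable_imp_abs_convergent_prod) (simp add: norm_mult norm_power)
  then show ?thesis
    by (rule abs_convergent_prod_imp_convergent_prod)
qed

lemma qpoch_tendsto:
  assumes "norm q < 1"
  shows "qpoch a q \<longlonglongrightarrow> qpoch_inf a q"
  using convergent_prod_LIMSEQ[OF convergent_prod_qpoch[OF assms, of a]]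
  unfolding qpoch_def qpoch_inf_def LIMSEQ_lessThan_iff_atMost .

lemma qpoch_inf_nonzero:
  assumes "norm a < 1" "norm q < 1"
  shows "qpoch_inf a q \<noteq> 0"
  unfolding qpoch_inf_def
  using convergent_prod_qpoch one_minus_qpow_nonzero assms by (intro prodinf_nonzero) auto

text \<open>This is \<open>F s n\<close> from the overview; the shift to \<open>Suc j\<close> makes
  the factors run over the exponents 1 to \<open>n\<close>. Writing s = -(z + 1/z), it is the
  product of the q-Pochhammer symbols (zq;q) and (q/z;q) of length \<open>n\<close>; keeping only
  the middle coefficient \<open>s\<close> exposes the linear dependence on it.\<close>

definition quadpoch :: "complex \<Rightarrow> complex \<Rightarrow> nat \<Rightarrow> complex" where
  "quadpoch s q n = (\<Prod>j<n. 1 + s * q ^ Suc j + (q ^ Suc j)\<^sup>2)"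

lemma quadpoch_0 [simp]: "quadpoch s q 0 = 1"
  by (simp add: quadpoch_def)

lemma quadpoch_Suc:
  "quadpoch s q (Suc n) = quadpoch s q n * (1 + s * q ^ Suc n + (q ^ Suc n)\<^sup>2)"
  by (simp add: quadpoch_def)

lemma quadpoch_minus_2: "quadpoch (-2) q n = (qpoch q q n)\<^sup>2"
  unfolding quadpoch_def qpoch_def prod_power_distrib
  by (intro prod.cong refl) (simp add: power2_eq_square algebra_simps)

lemma quadpoch_2: "quadpoch 2 q n = (qpoch (-q) q n)\<^sup>2"
  unfolding quadpoch_def qpoch_def prod_power_distrib
  by (intro prod.cong refl) (simp add: power2_eq_square algebra_simps)

lemma quadpoch_1:
  assumes "norm q < 1"
  shows "quadpoch 1 q n = qpoch (q ^ 3) (q ^ 3) n / qpoch q q n"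
proof -
  \<comment> \<open>In product form the identity can be checked factor by factor; the division is
    carried out once, at the end, where \<open>qpoch q q n\<close> is nonzero.\<close>
  have "quadpoch 1 q n * qpoch q q n = qpoch (q ^ 3) (q ^ 3) n"
    unfolding quadpoch_def qpoch_def prod.distrib[symmetric]
  proof (intro prod.cong refl)
    fix j
    have "(1 + x + x\<^sup>2) * (1 - x) = 1 - x ^ 3" for x :: complex
      by algebra
    from this[of "q ^ Suc j"]
    show "(1 + 1 * q ^ Suc j + (q ^ Suc j)\<^sup>2) * (1 - q * q ^ j) = 1 - q ^ 3 * (q ^ 3) ^ j"
      by (simp add: power_mult_distrib flip: power_mult) (simp add: mult.commute)
  qed
  then show ?thesis
    using qpoch_nonzero[OF assms assms, of n] by (simp add: field_simps)
qed

lemma quadpoch_minus_1: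
  assumes "norm q < 1"
  shows "quadpoch (-1) q n = qpoch (-(q ^ 3)) (q ^ 3) n / qpoch (-q) q n"
proof -
  have "quadpoch (-1) q n * qpoch (-q) q n = qpoch (-(q ^ 3)) (q ^ 3) n"
    unfolding quadpoch_def qpoch_def prod.distrib[symmetric]
  proof (intro prod.cong refl)
    fix j
    have "(1 - x + x\<^sup>2) * (1 + x) = 1 + x ^ 3" for x :: complex
      by algebra
    from this[of "q ^ Suc j"]
    show "(1 + -1 * q ^ Suc j + (q ^ Suc j)\<^sup>2) * (1 - -q * q ^ j) = 1 - -(q ^ 3) * (q ^ 3) ^ j"
      by (simp add: power_mult_distrib flip: power_mult) (simp add: mult.commute)
  qed
  then show ?thesis
    using qpoch_nonzero[of "-q" q n] assms by (simp add: field_simps)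
qed

text \<open>A vanishing factor stays in all later partial products and would force the limit 0. So a
  nonzero limit makes every denominator in the series nonzero, and no condition on the roots of 1 +
  s x + x^2 has to be stated.\<close>

lemma quadpoch_nonzero_if_tendsto:
  assumes "quadpoch s q \<longlonglongrightarrow> L" "L \<noteq> 0"
  shows "quadpoch s q n \<noteq> 0"
proof
  assume "quadpoch s q n = 0"
  have "quadpoch s q k = 0" if "k \<ge> n" for k
    using that by (induction rule: dec_induct) (simp_all add: quadpoch_Suc \<open>quadpoch s q n = 0\<close>)
  then have "eventually (\<lambda>k. quadpoch s q k = 0) sequentially"
    using eventually_sequentially by blast
  then have "quadpoch s q \<longlonglongrightarrow> 0"
    by (rule tendsto_eventually)
  with assms show False
    using LIMSEQ_unique by blast
qed

text \<open>Over the common denominator \<open>quadpoch t q (Suc n)\<close>, of which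
  \<open>quadpoch t q n\<close> is a factor, the constant and square terms of the two quadratics
  cancel and only the middle term remains.\<close>

lemma quadpoch_ratio_diff:
  assumes "quadpoch t q (Suc n) \<noteq> 0"
  shows "quadpoch s q (Suc n) / quadpoch t q (Suc n) - quadpoch s q n / quadpoch t q n
    = (s - t) * (q ^ Suc n * quadpoch s q n / quadpoch t q (Suc n))"
  using assms unfolding quadpoch_Suc by (simp add: divide_simps) algebra

text \<open>A convergent sequence is bounded, and the shift in the denominator does not affect the
  limit. The constant supplies the geometric majorants for the single and the double series.\<close>

lemma quadpoch_ratio_bounded:
  assumes "quadpoch s q \<longlonglongrightarrow> Ls" "quadpoch t q \<longlonglongrightarrow> Lt" "Lt \<noteq> 0"
  obtains C where "C > 0" "\<And>n. norm (quadpoch s q n / quadpoch t q (Suc n)) \<le> C"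
proof -
  have "(\<lambda>n. quadpoch s q n / quadpoch t q (Suc n)) \<longlonglongrightarrow> Ls / Lt"
    using assms by (intro tendsto_divide LIMSEQ_Suc)
  then have "Bseq (\<lambda>n. quadpoch s q n / quadpoch t q (Suc n))"
    using convergent_imp_Bseq convergentI by blast
  then show ?thesis
    using that by (auto elim: BseqE)
qed

text \<open>The tail from index \<open>k\<close> telescopes to the limit of the ratio minus its
  value at \<open>k\<close>. A geometric majorant gives absolute convergence, which turns the
  ordered sum into the unordered \<open>has_sum\<close> needed for the double series.\<close>

lemma quadpoch_tail_has_sum:
  assumes q: "norm q < 1"
    and lim: "quadpoch s q \<longlonglongrightarrow> Ls" "quadpoch t q \<longlonglongrightarrow> Lt" "Lt \<noteq> 0"
    and "s \<noteq> t"
  shows "((\<lambda>n. q ^ Suc (k + n) * quadpoch s q (k + n) / quadpoch t q (Suc (k + n))) has_sum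
    (Ls / Lt - quadpoch s q k / quadpoch t q k) / (s - t)) UNIV"
proof (rule norm_summable_imp_has_sum)
  obtain C where C: "C > 0" "\<And>n. norm (quadpoch s q n / quadpoch t q (Suc n)) \<le> C"
    using quadpoch_ratio_bounded[OF lim] by blast
  show "summable (\<lambda>n. norm (q ^ Suc (k + n) * quadpoch s q (k + n) / quadpoch t q (Suc (k + n))))"
  proof (rule summable_comparison_test')
    show "summable (\<lambda>n. norm q ^ n * C)"
      using q by (intro summable_mult2 summable_geometric) auto
    fix n :: nat
    have "norm q ^ Suc (k + n) \<le> norm q ^ n"
      using q by (intro power_decreasing) auto
    then have "norm q ^ Suc (k + n) * norm (quadpoch s q (k + n) / quadpoch t q (Suc (k + n)))
      \<le> norm q ^ n * C"
      using C by (intro mult_mono) auto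
    then show "norm (norm (q ^ Suc (k + n) * quadpoch s q (k + n) / quadpoch t q (Suc (k + n))))
      \<le> norm q ^ n * C"
      by (simp add: norm_mult norm_divide norm_power)
  qed
next
  have nz: "quadpoch t q n \<noteq> 0" for n
    using quadpoch_nonzero_if_tendsto[OF lim(2,3)] .
  have "(\<lambda>n. quadpoch s q (n + k) / quadpoch t q (n + k)) \<longlonglongrightarrow> Ls / Lt"
    using lim by (intro tendsto_divide LIMSEQ_ignore_initial_segment)
  from telescope_sums[OF this]
  have "(\<lambda>n. (s - t) * (q ^ Suc (k + n) * quadpoch s q (k + n) / quadpoch t q (Suc (k + n)))) sums
    (Ls / Lt - quadpoch s q k / quadpoch t q k)"
    unfolding add_Suc quadpoch_ratio_diff[OF nz] by (simp add: add.commute)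
  from sums_divide[OF this, of "s - t"]
  show "(\<lambda>n. q ^ Suc (k + n) * quadpoch s q (k + n) / quadpoch t q (Suc (k + n))) sums
    ((Ls / Lt - quadpoch s q k / quadpoch t q k) / (s - t))"
    using \<open>s \<noteq> t\<close> by simp
qed

text \<open>Algebra for the final value of the double sum: x = s - t and y = u - s, so x + y = u -
  t, while \<open>R\<close> and \<open>P\<close> stand for Lu / Ls and Ls / Lt, so that R * P is Lu
  / Lt.\<close>

lemma telescoped_total:
  fixes R P x y :: "'a :: field"
  assumes "x \<noteq> 0" "y \<noteq> 0" "x + y \<noteq> 0"
  shows "R / y * ((P - 1) / x) + - 1 / y * ((R * P - 1) / (x + y))
    = ((R * P - 1) / (x + y) - (R - 1) / y) / x"
  using assms by (simp add: divide_simps) (simp add: algebra_simps)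

text \<open>Summing over \<open>n\<close> first gives a tail of the telescoping series for the pair
  (u, s), hence a constant minus a ratio whose denominator cancels the numerator of the outer
  factor. The outer sum therefore splits into telescoping series for (s, t) and (u, t); the three
  inequalities keep the three divisors nonzero.\<close>

lemma quadpoch_double_has_sum:
  assumes q: "norm q < 1"
    and s: "quadpoch s q \<longlonglongrightarrow> Ls" "Ls \<noteq> 0"
    and t: "quadpoch t q \<longlonglongrightarrow> Lt" "Lt \<noteq> 0"
    and u: "quadpoch u q \<longlonglongrightarrow> Lu"
    and distinct: "s \<noteq> t" "u \<noteq> s" "u \<noteq> t"
  shows "((\<lambda>(m, n). q ^ (2 * m + n) * quadpoch s q (m - 1) * quadpoch u q (m + n - 1)
      / (quadpoch t q m * quadpoch s q (m + n))) has_sum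
    ((Lu / Lt - 1) / (u - t) - (Lu / Ls - 1) / (u - s)) / (s - t)) ({1..} \<times> UNIV)"
    (is "(?f has_sum ?S) _")
proof -
  define a where "a k = q ^ Suc k * quadpoch s q k / quadpoch t q (Suc k)" for k
  define b where "b k = q ^ Suc k * quadpoch u q k / quadpoch s q (Suc k)" for k
  define c where "c k = q ^ Suc k * quadpoch u q k / quadpoch t q (Suc k)" for k
  \<comment> \<open>With m = k + 1 the truncated subtractions become exact, and the exponent 2 m + n
    splits as (k + 1) + (k + n + 1), one part for each factor.\<close>
  have f: "?f (Suc k, n) = a k * b (k + n)" for k n
    by (simp add: a_def b_def mult_ac flip: power_add)
      (simp add: power_add power_mult power2_eq_square mult_ac)
  have nz: "quadpoch s q k \<noteq> 0" for k
    using quadpoch_nonzero_if_tendsto[OF s] .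
  \<comment> \<open>The value of the inner sum of \<open>b (k + n)\<close> over
    \<open>n\<close>.\<close>
  define r where "r k = (Lu / Ls - quadpoch u q k / quadpoch s q k) / (u - s)" for k
  have bij: "bij_betw (\<lambda>(k, n). (Suc k, n)) (UNIV \<times> UNIV) ({1..} \<times> (UNIV :: nat set))"
    by (rule bij_betwI[where g = "\<lambda>(k, n). (k - 1, n)"]) auto
  obtain C where C: "C > 0" "\<And>n. norm (quadpoch s q n / quadpoch t q (Suc n)) \<le> C"
    using quadpoch_ratio_bounded[OF s(1) t] by blast
  obtain D where D: "D > 0" "\<And>n. norm (quadpoch u q n / quadpoch s q (Suc n)) \<le> D"
    using quadpoch_ratio_bounded[OF u s] by blast
  have "((\<lambda>(k, n). a k * b (k + n)) has_sum ?S) (UNIV \<times> UNIV)"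
  proof (rule has_sum_SigmaI)
    fix k
    show "((\<lambda>n. case (k, n) of (k, n) \<Rightarrow> a k * b (k + n)) has_sum a k * r k) UNIV"
      using has_sum_cmult_right[OF quadpoch_tail_has_sum[OF q u s, of k], of "a k"] distinct
      by (simp add: b_def r_def)
  next
    have A: "(a has_sum (Ls / Lt - 1) / (s - t)) UNIV"
      using quadpoch_tail_has_sum[OF q s(1) t distinct(1), of 0] unfolding a_def by simp
    have c: "(c has_sum (Lu / Lt - 1) / (u - t)) UNIV"
      using quadpoch_tail_has_sum[OF q u t distinct(3), of 0] unfolding c_def by simp
    \<comment> \<open>The factor \<open>quadpoch s q k\<close> of \<open>a k\<close> cancels against
      the denominator of the ratio in \<open>r k\<close>, which turns that part into a multiple of
      \<open>c k\<close>.\<close>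
    have "a k * r k = (Lu / Ls / (u - s)) * a k + (- 1 / (u - s)) * c k" for k
      using nz[of k] quadpoch_nonzero_if_tendsto[OF t] s(2) distinct
      unfolding a_def c_def r_def by (simp add: divide_simps del: power_Suc) (simp add: algebra_simps)
    moreover have "((\<lambda>k. (Lu / Ls / (u - s)) * a k + (- 1 / (u - s)) * c k) has_sum
      (Lu / Ls / (u - s)) * ((Ls / Lt - 1) / (s - t)) + (- 1 / (u - s)) * ((Lu / Lt - 1) / (u - t))) UNIV"
      by (intro has_sum_add has_sum_cmult_right A c)
    moreover have "(Lu / Ls / (u - s)) * ((Ls / Lt - 1) / (s - t))
      + (- 1 / (u - s)) * ((Lu / Lt - 1) / (u - t)) = ?S"
      using telescoped_total[of "s - t" "u - s" "Lu / Ls" "Ls / Lt"] s(2) distinct by simp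
    ultimately show "((\<lambda>k. a k * r k) has_sum ?S) UNIV"
      by (simp only:)
  next
    \<comment> \<open>Iterated sums determine the double sum only if the whole family is summable.
      It is dominated by a product of two geometric series in \<open>k\<close> and
      \<open>n\<close>.\<close>
    have geo: "((\<lambda>n. norm q ^ n) has_sum 1 / (1 - norm q)) UNIV"
      using q by (intro sums_nonneg_imp_has_sum geometric_sums) auto
    have majorant: "(\<lambda>(k, n). C * D * norm q ^ k * norm q ^ n) summable_on (UNIV \<times> UNIV)"
    proof (rule summable_on_SigmaI)
      show "((\<lambda>n. case (k, n) of (k, n) \<Rightarrow> C * D * norm q ^ k * norm q ^ n) has_sum
        C * D * norm q ^ k * (1 / (1 - norm q))) UNIV" for k :: nat
        using has_sum_cmult_right[OF geo] by simp
      show "(\<lambda>k. C * D * norm q ^ k * (1 / (1 - norm q))) summable_on UNIV"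
        using geo by (intro summable_on_cmult_left summable_on_cmult_right) (auto simp: summable_on_def)
    qed (use C D in auto)
    have bound: "norm (a k * b (k + n)) \<le> C * D * norm q ^ k * norm q ^ n" for k n
    proof -
      \<comment> \<open>Of the exponent k + n + 1 only \<open>n\<close> is kept: the decay in
        \<open>k\<close> already comes from the factor \<open>a k\<close>.\<close>
      have "norm q ^ Suc k \<le> norm q ^ k" "norm q ^ Suc (k + n) \<le> norm q ^ n"
        using q by (intro power_decreasing; auto)+
      then have "norm q ^ Suc k * norm (quadpoch s q k / quadpoch t q (Suc k))
          * (norm q ^ Suc (k + n) * norm (quadpoch u q (k + n) / quadpoch s q (Suc (k + n))))
        \<le> norm q ^ k * C * (norm q ^ n * D)"
        using C D by (intro mult_mono) auto
      then show ?thesis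
        by (simp add: a_def b_def norm_mult norm_divide norm_power mult_ac)
    qed
    have "(\<lambda>x. norm (case x of (k, n) \<Rightarrow> a k * b (k + n))) summable_on UNIV \<times> UNIV"
      by (rule Infinite_Sum.abs_summable_on_comparison_test'[OF majorant]) (use bound in auto)
    then show "(\<lambda>(k, n). a k * b (k + n)) summable_on UNIV \<times> UNIV"
      by (rule abs_summable_summable)
  qed
  then have "((\<lambda>x. ?f (case x of (k, n) \<Rightarrow> (Suc k, n))) has_sum ?S) (UNIV \<times> UNIV)"
    unfolding f[symmetric] by (simp add: case_prod_unfold)
  then show ?thesis
    unfolding has_sum_reindex_bij_betw[OF bij] .
qed

theorem theorem2p5:
  fixes q :: complex
  assumes "norm q < 1"
  shows
    "(((\<lambda>(m, n).
        q ^ (2 * m + n) * qpoch (-q) q (m - 1) ^ 2 * qpoch (q ^ 3) (q ^ 3) (m + n - 1)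
          / (qpoch q q m ^ 2 * qpoch (-q) q (m + n) ^ 2 * qpoch q q (m + n - 1)))
      has_sum
        (1 / 12 * (qpoch_inf (q ^ 3) (q ^ 3) / qpoch_inf q q ^ 3)
          + 1 / 4 * (qpoch_inf (q ^ 3) (q ^ 3) / (qpoch_inf q q * qpoch_inf (-q) q ^ 2)) - 1 / 3))
      ({1..} \<times> UNIV))
    \<and>
     (((\<lambda>(m, n).
        q ^ (2 * m + n) * qpoch (q ^ 3) (q ^ 3) (m - 1) * qpoch (-q) q (m + n - 1) ^ 2 * qpoch q q (m + n)
          / (qpoch q q (m - 1) * qpoch q q m ^ 2 * qpoch (q ^ 3) (q ^ 3) (m + n)))
      has_sum
        (1 / 12 * (qpoch_inf (-q) q ^ 2 / qpoch_inf q q ^ 2)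
          - 1 / 3 * (qpoch_inf (-q) q ^ 2 * qpoch_inf q q / qpoch_inf (q ^ 3) (q ^ 3)) + 1 / 4))
      ({1..} \<times> UNIV))
    \<and>
     (((\<lambda>(m, n).
        q ^ (2 * m + n) * qpoch (-q) q (m - 1) ^ 2 * qpoch (-(q ^ 3)) (q ^ 3) (m + n - 1)
          / (qpoch q q m ^ 2 * qpoch (-q) q (m + n) ^ 2 * qpoch (-q) q (m + n - 1)))
      has_sum
        (1 / 4 * (qpoch_inf (-(q ^ 3)) (q ^ 3) / (qpoch_inf (-q) q * qpoch_inf q q ^ 2))
          + 1 / 12 * (qpoch_inf (-(q ^ 3)) (q ^ 3) / qpoch_inf (-q) q ^ 3) - 1 / 3))
      ({1..} \<times> UNIV))
    \<and>
     (((\<lambda>(m, n).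
        q ^ (2 * m + n) * qpoch (-(q ^ 3)) (q ^ 3) (m - 1) * qpoch (-q) q (m + n - 1) ^ 2 * qpoch (-q) q (m + n)
          / (qpoch (-q) q (m - 1) * qpoch q q m ^ 2 * qpoch (-(q ^ 3)) (q ^ 3) (m + n)))
      has_sum
        (1 / 4 * (qpoch_inf (-q) q ^ 2 / qpoch_inf q q ^ 2)
          - 1 / 3 * (qpoch_inf (-q) q ^ 3 / qpoch_inf (-(q ^ 3)) (q ^ 3)) + 1 / 12))
      ({1..} \<times> UNIV))"
proof -
  have q': "norm (-q) < 1" and q3: "norm (q ^ 3) < 1" "norm (-(q ^ 3)) < 1"
    using assms by (auto simp: norm_power power_less_one_iff)
  note nz = qpoch_inf_nonzero[OF assms assms] qpoch_inf_nonzero[OF q' assms]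
    qpoch_inf_nonzero[OF q3(1) q3(1)] qpoch_inf_nonzero[OF q3(2) q3(1)]
  note quadpoch_eqs = quadpoch_minus_2 quadpoch_2 quadpoch_1[OF assms] quadpoch_minus_1[OF assms]
  have lim: "quadpoch (-2) q \<longlonglongrightarrow> (qpoch_inf q q)\<^sup>2"
    "quadpoch 2 q \<longlonglongrightarrow> (qpoch_inf (-q) q)\<^sup>2"
    "quadpoch 1 q \<longlonglongrightarrow> qpoch_inf (q ^ 3) (q ^ 3) / qpoch_inf q q"
    "quadpoch (-1) q \<longlonglongrightarrow> qpoch_inf (-(q ^ 3)) (q ^ 3) / qpoch_inf (-q) q"
    unfolding quadpoch_eqs[abs_def]
    using nz assms q3 by (intro tendsto_intros qpoch_tendsto; simp)+
  have lim_nz: "(qpoch_inf q q)\<^sup>2 \<noteq> 0" "(qpoch_inf (-q) q)\<^sup>2 \<noteq> 0"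
    "qpoch_inf (q ^ 3) (q ^ 3) / qpoch_inf q q \<noteq> 0"
    "qpoch_inf (-(q ^ 3)) (q ^ 3) / qpoch_inf (-q) q \<noteq> 0"
    using nz by auto
  note has_sum = quadpoch_double_has_sum[OF assms]
  \<comment> \<open>Passes from the general sum to each of the four claims by matching terms on the
    index set and the values separately.\<close>
  have cong: "(g has_sum T) A"
    if "(f has_sum S) A" "S = T" "\<And>x. x \<in> A \<Longrightarrow> f x = g x"
    for f g :: "nat \<times> nat \<Rightarrow> complex" and S T A
    using that has_sum_cong by metis
  show ?thesis
  proof (intro conjI, goal_cases)
    case 1
    show ?case
    \<comment> \<open>Here (s, t, u) = (2, -2, 1). The first three goals say that these are
      distinct, the fourth compares the values of the sums, and the fifth compares the terms. The
      constant is (-1/3 - 1) / 4 = -1/3.\<close>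
    proof (rule cong[OF has_sum[OF lim(2) lim_nz(2) lim(1) lim_nz(1) lim(3)]], goal_cases)
      case 4
      show ?case
        using nz by (simp add: field_simps power2_eq_square power3_eq_cube)
    qed (auto simp: quadpoch_eqs mult_ac)
  next
    case 2
    show ?case
    \<comment> \<open>Here (s, t, u) = (1, -2, 2), with constant (-1/4 + 1) / 3 = 1/4.\<close>
    proof (rule cong[OF has_sum[OF lim(3) lim_nz(3) lim(1) lim_nz(1) lim(2)]], goal_cases)
      case 4
      show ?case
        using nz by (simp add: field_simps power2_eq_square power3_eq_cube)
    qed (auto simp: quadpoch_eqs mult_ac)
  next
    case 3
    show ?case
    \<comment> \<open>Here (s, t, u) = (2, -2, -1), with constant (-1 - 1/3) / 4 = -1/3.\<close>
    proof (rule cong[OF has_sum[OF lim(2) lim_nz(2) lim(1) lim_nz(1) lim(4)]], goal_cases)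
      case 4
      show ?case
        using nz by (simp add: field_simps power2_eq_square power3_eq_cube)
    qed (auto simp: quadpoch_eqs mult_ac)
  next
    case 4
    show ?case
    \<comment> \<open>Here (s, t, u) = (-1, -2, 2), with constant -1/4 + 1/3 = 1/12.\<close>
    proof (rule cong[OF has_sum[OF lim(4) lim_nz(4) lim(1) lim_nz(1) lim(2)]], goal_cases)
      case 4
      show ?case
        using nz by (simp add: field_simps power2_eq_square power3_eq_cube)
    qed (auto simp: quadpoch_eqs mult_ac)
  qed
qed

end
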